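(* Let $p$ be an odd prime, let $n$ be a positive integer, and let $$n=a_0+a_1p+a_2p^2+\cdots+a_kp^k,\qquad a_j\in\{0,1,\ldots,p-1\},$$ be the base $p$ expansion of $n$. Then $$L_p(n):=\sum_{l=1}^n\lambda_p(l)=\sum_{l=1}^{a_0}\lambda_p(l)+\sum_{l=1}^{a_1}\lambda_p(l)+\cdots+\sum_{l=1}^{a_k}\lambda_p(l),$$ where a sum $\sum_{l=1}^{a_j}$ is regarded as empty if $a_j=0$.
   Context: For a prime $p$, $\lambda_p(n)=(-1)^{\Omega_p(n)}$, where $\Omega_p(n)$ is the number of prime factors $q$ of $n$, counted with multiplicity, with Legendre symbol $\left(\frac{q}{p}\right)=-1$. Equivalently, $\lambda_p$ is the completely multiplicative function with $\lambda_p(p)=1$ and $\lambda_p(q)=\left(\frac{q}{p}\right)$ for primes $q\ne p$; thus $\lambda_p(p^km)=\left(\frac{m}{p}\right)$ when $p\nmid m$. *)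

theory Defs
  imports "HOL-Number_Theory.Number_Theory"
begin

text \<open>
  \<open>Omega_p p n\<close> counts, with multiplicity, the prime factors \<open>q\<close> of \<open>n\<close> with \<open>(q/p) = -1\<close>.
  The factor \<open>p\<close> itself is never counted, since \<open>(p/p) = 0\<close>.
\<close>

definition Omega_p :: "nat \<Rightarrow> nat \<Rightarrow> nat" where
  "Omega_p p n = size {#q \<in># prime_factorization n. Legendre (int q) (int p) = -1#}"

definition lambda_p :: "nat \<Rightarrow> nat \<Rightarrow> int" where
  "lambda_p p n = (-1) ^ Omega_p p n"

definition L_p :: "nat \<Rightarrow> nat \<Rightarrow> int" where
  "L_p p n = (\<Sum>l=1..n. lambda_p p l)"

end

theory Submission
  imports Defs
begin

text \<open>
  Write \<open>m = p q + r\<close> with \<open>r < p\<close>. If \<open>r > 0\<close> then \<open>\<lambda>\<^sub>p(m) = (r/p) = \<lambda>\<^sub>p(r)\<close>, and if \<open>r = 0\<close> then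
  \<open>\<lambda>\<^sub>p(m) = \<lambda>\<^sub>p(q)\<close>. As the Legendre symbol sums to zero over a complete residue system, each block
  \<open>p q + 1, \<dots>, p (q + 1)\<close> contributes exactly \<open>\<lambda>\<^sub>p(q + 1)\<close> to the summatory function, hence
  \<open>L\<^sub>p(p q + r) = L\<^sub>p(q) + L\<^sub>p(r)\<close>; this strips off one base \<open>p\<close> digit.
\<close>

section \<open>Legendre symbol: multiplicativity and vanishing sum\<close>

lemma Legendre_range: "Legendre a p \<in> {-1, 0, 1}"
  by (simp add: Legendre_def)

lemma Legendre_cong:
  assumes "[a = b] (mod p)"
  shows "Legendre a p = Legendre b p"
proof -
  have "[x = a] (mod p) \<longleftrightarrow> [x = b] (mod p)" for x
    using assms cong_trans cong_sym by metis
  moreover have "[a = 0] (mod p) \<longleftrightarrow> [b = 0] (mod p)"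
    using assms cong_trans cong_sym by metis
  ultimately show ?thesis
    by (simp add: Legendre_def QuadRes_def)
qed

text \<open>By Euler's criterion both sides are congruent modulo \<open>p\<close>. Each lies in {-1,
  0, 1}, so they differ by at most 2 < \<open>p\<close> and must coincide.\<close>

lemma Legendre_mult:
  assumes "prime p" "2 < p"
  shows "Legendre (a * b) (int p) = Legendre a (int p) * Legendre b (int p)"
proof -
  have "[Legendre (a * b) p = a ^ ((p - 1) div 2) * b ^ ((p - 1) div 2)] (mod p)"
    using euler_criterion[OF assms, of "a * b"] by (simp add: power_mult_distrib)
  moreover have "[Legendre a p * Legendre b p = a ^ ((p - 1) div 2) * b ^ ((p - 1) div 2)] (mod p)"
    using euler_criterion[OF assms] by (intro cong_mult) auto
  ultimately have "[Legendre (a * b) p = Legendre a p * Legendre b p] (mod p)"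
    using cong_trans cong_sym by blast
  then have dvd: "int p dvd Legendre (a * b) p - Legendre a p * Legendre b p"
    by (simp add: cong_iff_dvd_diff)
  have "\<bar>Legendre (a * b) p - Legendre a p * Legendre b p\<bar> < int p"
    using Legendre_range[of "a * b" p] Legendre_range[of a p] Legendre_range[of b p] assms(2)
    by auto
  then show ?thesis
    using dvd dvd_imp_le_int[of "Legendre (a * b) p - Legendre a p * Legendre b p" "int p"]
    by fastforce
qed

lemma Legendre_self: "Legendre p p = 0"
  by (simp add: Legendre_def cong_def)

lemma Legendre_nonzero:
  assumes "\<not> p dvd m"
  shows "Legendre (int m) (int p) \<noteq> 0"
  using assms by (simp add: Legendre_def cong_0_iff)

text \<open>Squaring modulo \<open>p\<close> sends both 1 and \<open>p - 1\<close> to 1. A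
  non-injective map on a finite set cannot cover that set, and any value of \<open>?S\<close> that
  it misses is a nonresidue.\<close>

lemma quadratic_nonresidue_exists:
  assumes "prime p" "2 < p"
  obtains g where "g \<in> {1..p - 1}" "Legendre (int g) (int p) = -1"
proof -
  let ?S = "{1..p - 1}"
  let ?f = "\<lambda>x. x ^ 2 mod p"
  have "\<not> inj_on ?f ?S"
  proof
    assume inj: "inj_on ?f ?S"
    \<comment> \<open>The collision is computed over the integers, where \<open>p - 1\<close> may be
      replaced by -1.\<close>
    have "int (p - 1) = int p - 1"
      using assms(2) by simp
    then have "[int (p - 1) = - 1] (mod int p)"
      by (simp add: cong_iff_dvd_diff)
    then have "[int (p - 1) ^ 2 = (- 1) ^ 2] (mod int p)"
      by (rule cong_pow)
    then have "[int ((p - 1) ^ 2) = int (1 ^ 2)] (mod int p)"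
      by (simp only: of_nat_power of_nat_1 power2_minus power_one)
    then have "?f (p - 1) = ?f 1"
      unfolding cong_int_iff by (simp add: cong_def)
    then have "p - 1 = 1"
      by (rule inj_onD[OF inj]) (use assms(2) in auto)
    with assms(2) show False by simp
  qed
  then have "\<not> ?S \<subseteq> ?f ` ?S"
    using finite_surj_inj[of ?S ?f] by blast
  then obtain g where g: "g \<in> ?S" "g \<notin> ?f ` ?S"
    by blast
  have "\<not> QuadRes (int p) (int g)"
  proof
    assume "QuadRes (int p) (int g)"
    then obtain y where y: "[y ^ 2 = int g] (mod int p)"
      by (auto simp: QuadRes_def)
    \<comment> \<open>The square root \<open>y\<close> is an arbitrary integer; its least residue is
      a candidate preimage of \<open>g\<close> in \<open>?S\<close>.\<close>
    define x where "x = nat (y mod int p)"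
    have x: "int x = y mod int p" "x < p"
      using assms(2) by (auto simp: x_def nat_less_iff)
    have "[int (x ^ 2) = int g] (mod int p)"
      using y by (simp add: x cong_def power_mod)
    then have "[x ^ 2 = g] (mod p)"
      by (simp only: cong_int_iff)
    moreover have "g < p"
      using g(1) assms(2) by auto
    ultimately have fx: "?f x = g"
      by (simp add: cong_def)
    have "x \<noteq> 0"
    proof
      assume "x = 0"
      with fx g(1) show False by simp
    qed
    with x(2) have "x \<in> ?S" by simp
    with fx g(2) show False by blast
  qed
  moreover have "\<not> p dvd g"
    using g(1) assms(2) by (auto dest: dvd_imp_le)
  ultimately have "Legendre (int g) (int p) = -1"
    by (simp add: Legendre_def cong_0_iff)
  with g(1) that show ?thesis by blast
qed

text \<open>Multiplication by a nonresidue \<open>g\<close> permutes the nonzero residues and flips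
  the sign of every symbol, so the sum equals its own negative.\<close>

lemma sum_Legendre_eq_0:
  assumes "prime p" "2 < p"
  shows "(\<Sum>l=1..p - 1. Legendre (int l) (int p)) = 0"
proof -
  let ?S = "{1..p - 1}"
  obtain g where g: "g \<in> ?S" "Legendre (int g) (int p) = -1"
    using quadratic_nonresidue_exists[OF assms] .
  have "\<not> p dvd g"
    using g(1) assms(2) by (auto dest: dvd_imp_le)
  then have cop: "coprime g p"
    using assms(1) prime_imp_coprime coprime_commute by blast
  let ?f = "\<lambda>x. g * x mod p"
  have inj: "inj_on ?f ?S"
  proof
    fix x y assume xy: "x \<in> ?S" "y \<in> ?S" "?f x = ?f y"
    then have "[x = y] (mod p)"
      using cop by (metis cong_def cong_mult_lcancel_nat)
    then show "x = y"
      using xy(1,2) by (intro cong_less_modulus_unique_nat[of x y p]) auto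
  qed
  have sub: "?f ` ?S \<subseteq> ?S"
  proof (intro image_subsetI)
    fix x assume x: "x \<in> ?S"
    then have "\<not> p dvd x"
      using assms(2) by (auto dest: dvd_imp_le)
    with \<open>\<not> p dvd g\<close> have "?f x \<noteq> 0"
      using assms(1) by (auto simp: prime_dvd_mult_iff mod_eq_0_iff_dvd)
    moreover have "?f x < p"
      using assms(2) by simp
    ultimately show "?f x \<in> ?S" by auto
  qed
  have "bij_betw ?f ?S ?S"
    using inj sub endo_inj_surj[of ?S ?f] by (simp add: bij_betw_def)
  then have "(\<Sum>l\<in>?S. Legendre (int l) (int p)) = (\<Sum>l\<in>?S. Legendre (int (?f l)) (int p))"
    by (rule sum.reindex_bij_betw[symmetric])
  also have "\<dots> = (\<Sum>l\<in>?S. Legendre (int g * int l) (int p))"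
    by (intro sum.cong refl Legendre_cong) (simp add: cong_def zmod_int)
  also have "\<dots> = - (\<Sum>l\<in>?S. Legendre (int l) (int p))"
    by (simp add: Legendre_mult[OF assms] g(2) sum_negf)
  finally show ?thesis by simp
qed

section \<open>Values of \<open>lambda_p\<close>\<close>

lemma lambda_p_mult:
  assumes "m > 0" "n > 0"
  shows "lambda_p p (m * n) = lambda_p p m * lambda_p p n"
  using assms by (simp add: lambda_p_def Omega_p_def prime_factorization_mult power_add)

lemma lambda_p_prime:
  assumes "prime q"
  shows "lambda_p p q = (if Legendre (int q) (int p) = -1 then -1 else 1)"
  using assms by (simp add: lambda_p_def Omega_p_def prime_factorization_prime)

lemma lambda_p_times_self:
  assumes "prime p" "m > 0"
  shows "lambda_p p (p * m) = lambda_p p m"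
  using assms by (simp add: lambda_p_mult lambda_p_prime prime_gt_0_nat Legendre_self)

text \<open>Both sides are multiplicative, so induction over the prime factors reduces the claim to
  primes other than \<open>p\<close>.\<close>

lemma lambda_p_eq_Legendre:
  assumes "prime p" "2 < p" "\<not> p dvd m"
  shows "lambda_p p m = Legendre (int m) (int p)"
  using assms(3)
proof (induction m rule: prime_divisors_induct)
  case zero
  then show ?case by simp
next
  case (unit x)
  have "Legendre 1 (int p) = 1"
  proof -
    have "QuadRes (int p) 1"
      unfolding QuadRes_def by (intro exI[of _ 1]) simp
    then show ?thesis
      using Legendre_nonzero[of p 1] assms(2) by (auto simp: Legendre_def)
  qed
  with unit show ?case
    by (simp add: lambda_p_def Omega_p_def)
next
  case (factor q x)
  then have nd: "\<not> p dvd q" "\<not> p dvd x"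
    by auto
  then have "x > 0"
    by (intro gr0I) auto
  \<comment> \<open>Since \<open>p\<close> does not divide \<open>q\<close>, the symbol is not 0,
    the one value at which the two functions would differ on a prime.\<close>
  have "lambda_p p q = Legendre (int q) (int p)"
    using Legendre_nonzero[OF nd(1)] Legendre_range[of "int q" "int p"] factor.hyps
    by (auto simp: lambda_p_prime)
  then show ?case
    using factor nd \<open>x > 0\<close>
    by (simp add: lambda_p_mult prime_gt_0_nat Legendre_mult[OF assms(1,2)])
qed

lemma lambda_p_add_multiple:
  assumes "prime p" "2 < p" "\<not> p dvd r"
  shows "lambda_p p (p * q + r) = lambda_p p r"
proof -
  have "\<not> p dvd p * q + r"
    using assms(3) by (simp add: dvd_add_right_iff)
  moreover have "Legendre (int (p * q + r)) (int p) = Legendre (int r) (int p)"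
    by (intro Legendre_cong) (simp add: cong_def)
  ultimately show ?thesis
    using assms by (simp add: lambda_p_eq_Legendre)
qed

section \<open>The summatory function and base \<open>p\<close> digits\<close>

lemma L_p_Suc: "L_p p (Suc n) = L_p p n + lambda_p p (Suc n)"
  by (simp add: L_p_def)

lemma L_p_0: "L_p p 0 = 0"
  by (simp add: L_p_def)

text \<open>With \<open>r < p\<close>, none of the \<open>r\<close> terms after \<open>p * q\<close>
  has an index divisible by \<open>p\<close>, so each depends only on its residue.\<close>

lemma L_p_block:
  assumes "prime p" "2 < p" "r < p"
  shows "L_p p (p * q + r) = L_p p (p * q) + L_p p r"
  using assms(3)
proof (induction r)
  case 0
  then show ?case by (simp add: L_p_0)
next
  case (Suc r)
  then have "\<not> p dvd Suc r"
    by (auto dest: dvd_imp_le)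
  then have "lambda_p p (p * q + Suc r) = lambda_p p (Suc r)"
    by (rule lambda_p_add_multiple[OF assms(1,2)])
  with Suc show ?case
    by (simp add: L_p_Suc)
qed

lemma L_p_pred_prime:
  assumes "prime p" "2 < p"
  shows "L_p p (p - 1) = 0"
proof -
  have "L_p p (p - 1) = (\<Sum>l=1..p - 1. Legendre (int l) (int p))"
    unfolding L_p_def using assms(2)
    by (intro sum.cong refl lambda_p_eq_Legendre assms) (auto dest: dvd_imp_le)
  then show ?thesis
    by (simp only: sum_Legendre_eq_0[OF assms])
qed

lemma L_p_times_self:
  assumes "prime p" "2 < p"
  shows "L_p p (p * q) = L_p p q"
proof (induction q)
  case 0
  then show ?case by simp
next
  case (Suc q)
  \<comment> \<open>The last index of the block is its only multiple of \<open>p\<close>; the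
    \<open>p - 1\<close> terms before it cancel.\<close>
  have "p * Suc q = Suc (p * q + (p - 1))"
    using assms(2) by simp
  then have "L_p p (p * Suc q) = L_p p (p * q + (p - 1)) + lambda_p p (p * Suc q)"
    by (simp only: L_p_Suc)
  also have "L_p p (p * q + (p - 1)) = L_p p q"
    using L_p_block[OF assms, of "p - 1" q] L_p_pred_prime[OF assms] assms(2) Suc by linarith
  also have "lambda_p p (p * Suc q) = lambda_p p (Suc q)"
    by (rule lambda_p_times_self) (use assms in auto)
  finally show ?case
    by (simp only: L_p_Suc)
qed

lemma L_p_base_expansion:
  assumes "prime p" "2 < p" "\<And>j. j \<le> k \<Longrightarrow> a j < p"
  shows "L_p p (\<Sum>j\<le>k. a j * p ^ j) = (\<Sum>j\<le>k. L_p p (a j))"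
  using assms(3)
proof (induction k arbitrary: a)
  case 0
  then show ?case by simp
next
  case (Suc k)
  \<comment> \<open>Horner's scheme: the lowest digit is split off, and the induction hypothesis is
    applied to the shifted digits, hence the generalization over \<open>a\<close>.\<close>
  have "(\<Sum>j\<le>Suc k. a j * p ^ j) = p * (\<Sum>j\<le>k. a (Suc j) * p ^ j) + a 0"
    unfolding sum.atMost_Suc_shift by (simp add: sum_distrib_left mult_ac)
  then have "L_p p (\<Sum>j\<le>Suc k. a j * p ^ j) = L_p p (\<Sum>j\<le>k. a (Suc j) * p ^ j) + L_p p (a 0)"
    using Suc.prems[of 0] by (simp only: L_p_block[OF assms(1,2)] L_p_times_self[OF assms(1,2)])
  also have "L_p p (\<Sum>j\<le>k. a (Suc j) * p ^ j) = (\<Sum>j\<le>k. L_p p (a (Suc j)))"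
    using Suc.prems by (intro Suc.IH) simp
  finally show ?case
    unfolding sum.atMost_Suc_shift by simp
qed

theorem theorem8:
  fixes p n k :: nat and a :: "nat \<Rightarrow> nat"
  assumes "prime p" and "odd p"
    and "n > 0"
    and "\<And>j. j \<le> k \<Longrightarrow> a j \<in> {0..p - 1}"
    and "n = (\<Sum>j\<le>k. a j * p ^ j)"
  shows "L_p p n = (\<Sum>j\<le>k. \<Sum>l=1..a j. lambda_p p l)"
proof -
  have "2 < p"
    using assms(1,2) prime_ge_2_nat[of p] by (cases "p = 2") auto
  moreover have "a j < p" if "j \<le> k" for j
    using assms(4)[OF that] \<open>2 < p\<close> by auto
  ultimately show ?thesis
    using L_p_base_expansion[OF assms(1), of k a] assms(5) by (simp add: L_p_def)
qed

end
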